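(* For all integers $n> r\ge 1$, it holds that $T(n,r+1,r)\le \frac{6.239}{r+1}\binom{n}{r}$. Moreover, there is an integer $r_0$ such that for all integers $n>r\ge r_0$, it holds that $T(n,r+1,r)\le \frac{4.911}{r+1}\binom{n}{r}$.
   Context: An $r$-graph on a vertex set $V$ is a collection of $r$-subsets of $V$ (edges). For positive integers $n\ge s>r$, a Turán $(n,s,r)$-system is an $r$-graph $G$ on an $n$-element set $V$ such that every $s$-subset $X\subseteq V$ contains at least one edge of $G$. The Turán number $T(n,s,r)$ is the minimum number of edges of a Turán $(n,s,r)$-system. *)

theory Defs
  imports Complex_Main "HOL-Library.Ramsey"
begin

definition r_graph :: "'a set \<Rightarrow> nat \<Rightarrow> 'a set set \<Rightarrow> bool" where
  "r_graph V r G \<longleftrightarrow> G \<subseteq> nsets V r"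

definition turan_system :: "'a set \<Rightarrow> nat \<Rightarrow> nat \<Rightarrow> 'a set set \<Rightarrow> bool" where
  "turan_system V s r G \<longleftrightarrow> r_graph V r G \<and> (\<forall>X\<in>nsets V s. \<exists>e\<in>G. e \<subseteq> X)"

text \<open>
  The vertex set is fixed to be \<open>{..<n}\<close>; lemma \<open>turan_number_eq\<close> below shows that every
  n-element set, of any type, gives the same value. For \<open>r \<le> s\<close> the minimum is attained (lemma
  \<open>turan_number_attained\<close>), so \<open>LEAST\<close> is never applied to an unsatisfiable predicate.
\<close>

definition turan_number :: "nat \<Rightarrow> nat \<Rightarrow> nat \<Rightarrow> nat" where
  "turan_number n s r = (LEAST m. \<exists>G. turan_system {..<n} s r G \<and> card G = m)"

lemma turan_system_complete:
  assumes "r \<le> s"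
  shows "turan_system V s r (nsets V r)"
  unfolding turan_system_def r_graph_def
proof (intro conjI ballI subset_refl)
  fix X assume "X \<in> nsets V s"
  then have X: "X \<subseteq> V" "finite X" "card X = s"
    by (auto simp: nsets_def)
  then obtain e where "e \<subseteq> X" "card e = r" "finite e"
    using assms by (metis obtain_subset_with_card_n)
  then show "\<exists>e\<in>nsets V r. e \<subseteq> X"
    using X by (auto simp: nsets_def)
qed

lemma turan_number_attained:
  assumes "r \<le> s"
  shows "\<exists>G. turan_system {..<n} s r G \<and> card G = turan_number n s r"
  unfolding turan_number_def
  by (rule LeastI_ex) (use turan_system_complete[OF assms] in blast)

lemma turan_system_image:
  assumes f: "bij_betw f V W" and G: "turan_system V s r G"
  shows "turan_system W s r ((`) f ` G) \<and> card ((`) f ` G) = card G"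
proof -
  have inj: "inj_on f V" and W: "f ` V = W"
    using f by (auto simp: bij_betw_def)
  have GV: "e \<subseteq> V" "finite e" "card e = r" if "e \<in> G" for e
    using G that by (auto simp: turan_system_def r_graph_def nsets_def)
  have "inj_on ((`) f) G"
    using GV(1) by (intro inj_onI) (metis inj inj_on_image_eq_iff)
  then have card: "card ((`) f ` G) = card G"
    by (rule card_image)
  have edges: "(`) f ` G \<subseteq> nsets W r"
    using GV W card_image[OF inj_on_subset[OF inj]] by (auto simp: nsets_def)
  have "\<exists>e\<in>(`) f ` G. e \<subseteq> X" if "X \<in> nsets W s" for X
  proof -
    have X: "X \<subseteq> f ` V" "finite X" "card X = s"
      using that W by (auto simp: nsets_def)
    then obtain Y where Y: "Y \<subseteq> V" "X = f ` Y"
      by (auto simp: subset_image_iff)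
    have "inj_on f Y"
      using inj Y(1) by (rule inj_on_subset)
    then have "Y \<in> nsets V s"
      using X Y by (auto simp: nsets_def card_image dest: finite_imageD)
    then obtain e where "e \<in> G" "e \<subseteq> Y"
      using G by (auto simp: turan_system_def)
    then show ?thesis
      using Y(2) by blast
  qed
  with card edges show ?thesis
    by (simp add: turan_system_def r_graph_def)
qed

lemma turan_number_eq:
  assumes "finite V" "card V = n"
  shows "turan_number n s r = (LEAST m. \<exists>G. turan_system V s r G \<and> card G = m)"
proof -
  obtain f where f: "bij_betw f V {..<n}"
    using assms by (metis ex_bij_betw_finite_nat lessThan_atLeast0)
  have "(\<exists>G. turan_system {..<n} s r G \<and> card G = m) \<longleftrightarrow> (\<exists>G. turan_system V s r G \<and> card G = m)"
    for m
    using turan_system_image[OF f] turan_system_image[OF bij_betw_inv_into[OF f]] by metis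
  then show ?thesis
    by (simp add: turan_number_def)
qed

end

(* Let M = r + 1 = j + l with j, l \<ge> 1, and order the vertices. Choose a random family P of
   (j - 1)-sets, each with probability p. Take every r-set whose first j - 1 elements form a member
   of P, and, for every j-set Z without a subset in P, all sets consisting of Z followed by an edge
   of an optimal Turan (., l, l - 1)-system on the vertices above Z. Every M-set X contains such a
   set: look at its first j elements Z, and delete an element of Z if some (j - 1)-subset of Z is
   in P, or an element of X - Z otherwise. Hence the best density constants d satisfy
   d(M) \<le> p + (1 - p)^j d(l). With p = c/j and (1 - p)^j \<le> exp (-c), the numbers M d(M) are
   bounded, inductively by 6.239 with c = 2 and j about M/2, and then, with c = 5/2 and j about
   5M/7, the map B \<mapsto> 7/2 + (7/2) exp (-5/2) B, with fixed point below 4.911, can be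
   iterated on eventual upper bounds. *)
theory Submission
  imports Defs
begin

section \<open>The recursive construction\<close>

text \<open>The method of conditional expectations: \<open>P\<close> is a random subset of \<open>E\<close>
  containing each element independently with probability \<open>p\<close>.\<close>

lemma exists_subset_le_expected_cost:
  fixes a :: "'a \<Rightarrow> real" and b :: "'b \<Rightarrow> real"
  assumes "finite E" "finite Z" "\<And>z. z \<in> Z \<Longrightarrow> N z \<subseteq> E" "0 \<le> p" "p \<le> 1"
  shows "\<exists>P\<subseteq>E. sum a P + (\<Sum>z | z \<in> Z \<and> N z \<inter> P = {}. b z)
           \<le> p * sum a E + (\<Sum>z\<in>Z. (1 - p) ^ card (N z) * b z)"
  using assms(1-3)
proof (induction E arbitrary: Z N rule: finite_induct)
  case empty
  then have "N z = {}" if "z \<in> Z" for z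
    using that by blast
  then show ?case by simp
next
  case (insert x E)
  let ?w = "\<lambda>z. (1 - p) ^ card (N z) * b z"
  define Z0 where "Z0 = {z \<in> Z. x \<notin> N z}"
  define Z1 where "Z1 = {z \<in> Z. x \<in> N z}"
  have Z: "Z = Z0 \<union> Z1" "Z0 \<inter> Z1 = {}" "finite Z0" "finite Z1"
    using insert.prems(1) by (auto simp: Z0_def Z1_def)
  define c1 where "c1 = a x + p * sum a E + sum ?w Z0"
  define c0 where "c0 = p * sum a E + (\<Sum>z\<in>Z. (1 - p) ^ card (N z - {x}) * b z)"
  obtain P1 where P1: "P1 \<subseteq> E"
    "sum a P1 + (\<Sum>z | z \<in> Z0 \<and> N z \<inter> P1 = {}. b z) \<le> p * sum a E + sum ?w Z0"
    using insert.IH[of Z0 N] insert.prems Z(3) by (auto simp: Z0_def)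
  obtain P0 where P0: "P0 \<subseteq> E"
    "sum a P0 + (\<Sum>z | z \<in> Z \<and> (N z - {x}) \<inter> P0 = {}. b z) \<le> c0"
    using insert.IH[of Z "\<lambda>z. N z - {x}"] insert.prems unfolding c0_def by auto
  have "{z. z \<in> Z0 \<and> N z \<inter> P1 = {}} = {z. z \<in> Z \<and> N z \<inter> insert x P1 = {}}"
    by (auto simp: Z0_def)
  moreover have "sum a (insert x P1) = a x + sum a P1"
    using P1(1) insert.hyps by (intro sum.insert) (auto intro: finite_subset)
  ultimately have le1:
    "sum a (insert x P1) + (\<Sum>z | z \<in> Z \<and> N z \<inter> insert x P1 = {}. b z) \<le> c1"
    using P1(2) by (simp add: c1_def)
  have "{z. z \<in> Z \<and> (N z - {x}) \<inter> P0 = {}} = {z. z \<in> Z \<and> N z \<inter> P0 = {}}"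
    using P0(1) insert.hyps by auto
  then have le0: "sum a P0 + (\<Sum>z | z \<in> Z \<and> N z \<inter> P0 = {}. b z) \<le> c0"
    using P0(2) by simp
  have w0: "(\<Sum>z\<in>Z0. (1 - p) ^ card (N z - {x}) * b z) = sum ?w Z0"
    by (rule sum.cong) (auto simp: Z0_def)
  have w1: "(1 - p) * (\<Sum>z\<in>Z1. (1 - p) ^ card (N z - {x}) * b z) = sum ?w Z1"
    unfolding sum_distrib_left
  proof (rule sum.cong)
    fix z assume z: "z \<in> Z1"
    then have x: "x \<in> N z" and "N z \<subseteq> insert x E"
      using insert.prems(2) by (auto simp: Z1_def)
    then have "finite (N z)"
      using insert.hyps(1) by (meson finite.insertI finite_subset)
    then have "card (N z) = Suc (card (N z - {x}))"
      using x by (rule card.remove)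
    then show "(1 - p) * ((1 - p) ^ card (N z - {x}) * b z) = ?w z"
      by (simp only: power_Suc mult.assoc)
  qed simp
  define t where "t = p * sum a (insert x E) + sum ?w Z"
  have "p * c1 + (1 - p) * c0 = p * a x + p * sum a E + sum ?w Z0
      + (1 - p) * (\<Sum>z\<in>Z1. (1 - p) ^ card (N z - {x}) * b z)"
    unfolding c1_def c0_def Z(1) sum.union_disjoint[OF Z(3,4,2)] w0
    by (simp add: algebra_simps)
  also have "\<dots> = t"
    unfolding t_def w1 Z(1) sum.union_disjoint[OF Z(3,4,2)]
    using insert.hyps by (simp add: algebra_simps)
  finally have mean: "p * c1 + (1 - p) * c0 = t" .
  have "c1 \<le> t \<or> c0 \<le> t"
  proof (rule ccontr)
    assume "\<not> ?thesis"
    then have "t < min c1 c0" by simp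
    also have "\<dots> = p * min c1 c0 + (1 - p) * min c1 c0"
      by (simp add: algebra_simps)
    also have "\<dots> \<le> p * c1 + (1 - p) * c0"
      using assms(4,5) by (intro add_mono mult_left_mono) auto
    finally show False using mean by simp
  qed
  then show ?case
  proof
    assume "c1 \<le> t"
    then show ?thesis
      using le1 P1(1) unfolding t_def by (intro exI[of _ "insert x P1"]) auto
  next
    assume "c0 \<le> t"
    then show ?thesis
      using le0 P0(1) unfolding t_def by (intro exI[of _ P0]) auto
  qed
qed

section \<open>Initial segments, tails and counting by initial segments\<close>

lemma exists_initial_segment:
  fixes X :: "'a::linorder set"
  assumes "finite X" "k \<le> card X"
  shows "\<exists>Z\<subseteq>X. card Z = k \<and> (\<forall>z\<in>Z. \<forall>x\<in>X - Z. z < x)"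
  using assms(2)
proof (induction k)
  case 0
  show ?case by (intro exI[of _ "{}"]) simp
next
  case (Suc k)
  then obtain Z where Z: "Z \<subseteq> X" "card Z = k" "\<forall>z\<in>Z. \<forall>x\<in>X - Z. z < x"
    by auto
  have fin: "finite Z" "finite (X - Z)"
    using Z(1) assms(1) by (auto intro: finite_subset)
  have ne: "X - Z \<noteq> {}"
    using Z Suc.prems by auto
  let ?m = "Min (X - Z)"
  have m: "?m \<in> X - Z"
    using fin ne by (rule_tac Min_in)
  have "z < x" if "z \<in> insert ?m Z" "x \<in> X - insert ?m Z" for z x
    using that Z(3) Min_le[OF fin(2), of x] by (auto simp: order.strict_iff_order)
  then show ?case
    using Z m fin by (intro exI[of _ "insert ?m Z"]) auto
qed

definition tail :: "nat \<Rightarrow> nat set \<Rightarrow> nat set" where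
  "tail n A = {x. x < n \<and> (\<forall>a\<in>A. a < x)}"

lemma finite_tail [simp]: "finite (tail n A)"
  by (simp add: tail_def)

lemma Un_tail_in_nsets:
  assumes "A \<in> nsets {..<n} i" "B \<in> nsets (tail n A) l"
  shows "A \<union> B \<in> nsets {..<n} (i + l)"
proof -
  have "A \<inter> B = {}"
    using assms by (auto simp: nsets_def tail_def)
  then show ?thesis
    using assms by (auto simp: nsets_def tail_def card_Un_disjoint)
qed

text \<open>A pair \<open>(A, B)\<close> with \<open>B\<close> above \<open>A\<close> can be
  recovered from \<open>A \<union> B\<close>, since \<open>A\<close> consists of its first
  \<open>k\<close> elements. Distinct pairs therefore give distinct
  \<open>(k + l)\<close>-sets.\<close>

lemma sum_choose_card_tail_le:
  "(\<Sum>A\<in>nsets {..<n} k. card (tail n A) choose l) \<le> n choose (k + l)"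
proof -
  let ?S = "SIGMA A:nsets {..<n} k. nsets (tail n A) l"
  have inj: "inj_on (\<lambda>(A, B). A \<union> B) ?S"
  proof (rule inj_onI, clarify)
    fix A B A' B'
    assume A: "A \<in> nsets {..<n} k" "A' \<in> nsets {..<n} k"
      and B: "B \<in> nsets (tail n A) l" "B' \<in> nsets (tail n A') l"
      and eq: "A \<union> B = A' \<union> B'"
    have lt: "a < b" if "a \<in> A" "b \<in> B" for a b
      using that B by (auto simp: nsets_def tail_def)
    have lt': "a < b" if "a \<in> A'" "b \<in> B'" for a b
      using that B by (auto simp: nsets_def tail_def)
    \<comment> \<open>If neither contained the other, some \<open>a\<close> would lie in both
      \<open>A\<close> and \<open>B'\<close>, and some \<open>a'\<close> in both \<open>A'\<close>
      and \<open>B\<close>, giving \<open>a < a'\<close> and \<open>a' < a\<close>.\<close>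
    have "A \<subseteq> A' \<or> A' \<subseteq> A"
    proof (rule ccontr)
      assume "\<not> ?thesis"
      then obtain a a' where "a \<in> A" "a \<notin> A'" "a' \<in> A'" "a' \<notin> A"
        by blast
      then show False
        using eq lt[of a a'] lt'[of a' a] by (metis Un_iff less_asym)
    qed
    then have "A = A'"
      using A unfolding nsets_def by (metis (mono_tags, lifting) card_subset_eq mem_Collect_eq)
    moreover have "B = A \<union> B - A" "B' = A' \<union> B' - A'"
      using lt lt' by blast+
    ultimately show "A = A' \<and> B = B'"
      using eq by metis
  qed
  have img: "(\<lambda>(A, B). A \<union> B) ` ?S \<subseteq> nsets {..<n} (k + l)"
    using Un_tail_in_nsets by auto
  have "(\<Sum>A\<in>nsets {..<n} k. card (tail n A) choose l) = card ?S"
    by (simp add: card_SigmaI finite_imp_finite_nsets card_nsets)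
  also have "\<dots> \<le> card (nsets {..<n} (k + l))"
    by (rule card_inj_on_le[OF inj img]) (simp add: finite_imp_finite_nsets)
  finally show ?thesis
    by (simp add: card_nsets)
qed

section \<open>Density bounds and their recursion\<close>

text \<open>All \<open>n\<close> are included because the recursion applies the bound to tails of
  every size. The case \<open>n = r\<close> forces \<open>0 \<le> d\<close>.\<close>

definition turan_density_le :: "nat \<Rightarrow> real \<Rightarrow> bool" where
  "turan_density_le r d \<longleftrightarrow> (\<forall>n. real (turan_number n (r + 1) r) \<le> d * real (n choose r))"

lemma turan_number_le:
  assumes "turan_system {..<n} s r G"
  shows "turan_number n s r \<le> card G"
  unfolding turan_number_def using assms by (intro Least_le) blast

lemma turan_density_le_mono:
  assumes "turan_density_le r d" "d \<le> d'"
  shows "turan_density_le r d'"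
  using assms unfolding turan_density_le_def
  by (meson mult_right_mono of_nat_0_le_iff order_trans)

lemma turan_density_le_1: "turan_density_le r 1"
  unfolding turan_density_le_def
  using turan_number_le[OF turan_system_complete, of r "r + 1"] by (simp add: card_nsets)

lemma turan_density_leD:
  assumes "turan_density_le r d" "finite V"
  shows "\<exists>G. turan_system V (r + 1) r G \<and> real (card G) \<le> d * real (card V choose r)"
proof -
  have "\<exists>m G. turan_system V (r + 1) r G \<and> card G = m"
    using turan_system_complete[of r "r + 1"] by auto
  then have "\<exists>G. turan_system V (r + 1) r G \<and> card G = turan_number (card V) (r + 1) r"
    unfolding turan_number_eq[OF assms(2) refl] by (rule LeastI_ex)
  then show ?thesis
    using assms(1) unfolding turan_density_le_def by metis
qed

text \<open>This is the construction with initial segments of size \<open>k + 1\<close> and members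
  of \<open>P\<close> of size \<open>k\<close>. A \<open>(k + 1)\<close>-set has
  \<open>k + 1\<close> subsets of size \<open>k\<close>, so it avoids \<open>P\<close> with
  probability \<open>(1 - p) ^ (k + 1)\<close>. Summed over initial sets, the tail counts add up to
  at most \<open>n choose (k + m + 1)\<close> for each of the two kinds of edges.\<close>

lemma turan_density_le_rec:
  assumes "turan_density_le m d" "0 \<le> p" "p \<le> 1"
  shows "turan_density_le (k + m + 1) (p + (1 - p) ^ (k + 1) * d)"
  unfolding turan_density_le_def
proof
  fix n :: nat
  let ?V = "{..<n}"
  have "\<exists>H. turan_system (tail n Z) (m + 1) m H
          \<and> real (card H) \<le> d * real (card (tail n Z) choose m)" for Z
    using turan_density_leD[OF assms(1) finite_tail] .
  then obtain H where H: "\<And>Z. turan_system (tail n Z) (m + 1) m (H Z)"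
    "\<And>Z. real (card (H Z)) \<le> d * real (card (tail n Z) choose m)"
    by metis
  \<comment> \<open>\<open>a A\<close> is the price of putting \<open>A\<close> into
    \<open>P\<close>; \<open>b Z\<close> is the price of leaving \<open>Z\<close> without a subset
    in \<open>P\<close>.\<close>
  define a where "a A = real (card (tail n A) choose (m + 1))" for A
  define b where "b Z = real (card (H Z))" for Z
  define N where "N Z = nsets Z k" for Z :: "nat set"
  have N_card: "card (N Z) = k + 1" if "Z \<in> nsets ?V (k + 1)" for Z
    using that by (auto simp: N_def nsets_def[of ?V] card_nsets)
  have "\<exists>P\<subseteq>nsets ?V k. sum a P + (\<Sum>Z | Z \<in> nsets ?V (k + 1) \<and> N Z \<inter> P = {}. b Z)
      \<le> p * sum a (nsets ?V k) + (\<Sum>Z\<in>nsets ?V (k + 1). (1 - p) ^ card (N Z) * b Z)"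
    using assms(2,3)
    by (intro exists_subset_le_expected_cost)
       (auto simp: finite_imp_finite_nsets N_def nsets_def)
  then obtain P where P: "P \<subseteq> nsets ?V k"
    "sum a P + (\<Sum>Z | Z \<in> nsets ?V (k + 1) \<and> N Z \<inter> P = {}. b Z)
      \<le> p * sum a (nsets ?V k) + (\<Sum>Z\<in>nsets ?V (k + 1). (1 - p) ^ card (N Z) * b Z)"
    by blast
  define Bad where "Bad = {Z. Z \<in> nsets ?V (k + 1) \<and> N Z \<inter> P = {}}"
  define G1 where "G1 = (\<Union>A\<in>P. (\<union>) A ` nsets (tail n A) (m + 1))"
  define G2 where "G2 = (\<Union>Z\<in>Bad. (\<union>) Z ` H Z)"
  have finP: "finite P"
    using P(1) finite_imp_finite_nsets[of ?V k] by (auto intro: finite_subset)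
  have finBad: "finite Bad"
    using finite_imp_finite_nsets[of ?V "k + 1"] unfolding Bad_def by auto
  have H_sub: "H Z \<subseteq> nsets (tail n Z) m" for Z
    using H(1)[of Z] by (simp add: turan_system_def r_graph_def)
  then have finH: "finite (H Z)" for Z
    by (rule finite_subset) (simp add: finite_imp_finite_nsets)
  have system: "turan_system ?V (k + m + 1 + 1) (k + m + 1) (G1 \<union> G2)"
    unfolding turan_system_def r_graph_def
  proof (intro conjI ballI)
    have "G1 \<subseteq> nsets ?V (k + m + 1)"
      using P(1) Un_tail_in_nsets[of _ n k _ "m + 1"] by (auto simp: G1_def add.assoc)
    moreover have "G2 \<subseteq> nsets ?V (k + m + 1)"
      using H_sub Un_tail_in_nsets[of _ n "k + 1" _ m] by (auto simp: G2_def Bad_def add_ac)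
    ultimately show "G1 \<union> G2 \<subseteq> nsets ?V (k + m + 1)"
      by blast
  next
    fix X assume "X \<in> nsets ?V (k + m + 1 + 1)"
    then have X: "X \<subseteq> ?V" "finite X" "card X = k + m + 2"
      by (auto simp: nsets_def)
    then obtain Z where Z: "Z \<subseteq> X" "card Z = k + 1" "\<forall>z\<in>Z. \<forall>x\<in>X - Z. z < x"
      using exists_initial_segment[of X "k + 1"] by auto
    have finZ: "finite Z"
      using Z(1) X(2) by (rule finite_subset)
    have card: "card (X - Z) = m + 1"
      using X Z finZ by (simp add: card_Diff_subset)
    have rest: "X - Z \<in> nsets (tail n A) (m + 1)" if "A \<subseteq> Z" for A
      using that X Z card by (auto simp: nsets_def tail_def)
    show "\<exists>e\<in>G1 \<union> G2. e \<subseteq> X"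
    proof (cases "N Z \<inter> P = {}")
      case True
      then have bad: "Z \<in> Bad"
        using X Z finZ by (auto simp: Bad_def nsets_def)
      obtain e where e: "e \<in> H Z" "e \<subseteq> X - Z"
        using H(1)[of Z] rest[OF subset_refl] by (auto simp: turan_system_def)
      have "Z \<union> e \<in> G2"
        using bad e(1) by (auto simp: G2_def)
      moreover have "Z \<union> e \<subseteq> X"
        using e(2) Z(1) by auto
      ultimately show ?thesis
        by blast
    next
      case False
      then obtain A where A: "A \<in> P" "A \<subseteq> Z"
        by (auto simp: N_def nsets_def)
      \<comment> \<open>Since \<open>A\<close> has one element fewer than \<open>Z\<close>, this
        edge is \<open>X\<close> with one vertex of \<open>Z\<close> deleted.\<close>
      then have "A \<union> (X - Z) \<in> G1"
        using rest by (auto simp: G1_def)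
      moreover have "A \<union> (X - Z) \<subseteq> X"
        using A(2) Z(1) by auto
      ultimately show ?thesis
        by blast
    qed
  qed
  have "card G1 \<le> (\<Sum>A\<in>P. card ((\<union>) A ` nsets (tail n A) (m + 1)))"
    unfolding G1_def by (rule card_UN_le[OF finP])
  also have "\<dots> \<le> (\<Sum>A\<in>P. card (tail n A) choose (m + 1))"
    by (intro sum_mono) (metis card_image_le card_nsets finite_imp_finite_nsets finite_tail)
  finally have "real (card G1) \<le> sum a P"
    unfolding a_def by (metis of_nat_le_iff of_nat_sum)
  moreover have "card G2 \<le> (\<Sum>Z\<in>Bad. card ((\<union>) Z ` H Z))"
    unfolding G2_def by (rule card_UN_le[OF finBad])
  then have "card G2 \<le> (\<Sum>Z\<in>Bad. card (H Z))"
    by (rule order_trans) (intro sum_mono card_image_le finH)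
  then have "real (card G2) \<le> sum b Bad"
    unfolding b_def by (metis of_nat_le_iff of_nat_sum)
  moreover have "real (card (G1 \<union> G2)) \<le> real (card G1) + real (card G2)"
    using card_Un_le[of G1 G2] by linarith
  ultimately have "real (card (G1 \<union> G2))
      \<le> p * sum a (nsets ?V k) + (\<Sum>Z\<in>nsets ?V (k + 1). (1 - p) ^ card (N Z) * b Z)"
    using P(2) unfolding Bad_def by linarith
  also have "(\<Sum>Z\<in>nsets ?V (k + 1). (1 - p) ^ card (N Z) * b Z)
      \<le> (\<Sum>Z\<in>nsets ?V (k + 1). (1 - p) ^ (k + 1) * (d * real (card (tail n Z) choose m)))"
    using H(2) assms(3) unfolding b_def
    by (intro sum_mono) (simp only: N_card, intro mult_left_mono, auto)
  also have "\<dots> = (1 - p) ^ (k + 1) * d * real (\<Sum>Z\<in>nsets ?V (k + 1). card (tail n Z) choose m)"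
    by (simp add: sum_distrib_left mult.assoc)
  finally have le: "real (card (G1 \<union> G2)) \<le> p * sum a (nsets ?V k)
      + (1 - p) ^ (k + 1) * d * real (\<Sum>Z\<in>nsets ?V (k + 1). card (tail n Z) choose m)"
    by simp
  \<comment> \<open>The density bound is used at \<open>n = m\<close>, where the binomial
    coefficient is 1.\<close>
  have "0 \<le> d * real (m choose m)"
    using assms(1) unfolding turan_density_le_def by (meson of_nat_0_le_iff order_trans)
  then have d0: "0 \<le> d" by simp
  have "sum a (nsets ?V k) = real (\<Sum>A\<in>nsets ?V k. card (tail n A) choose (m + 1))"
    by (simp add: a_def)
  also have "\<dots> \<le> real (n choose (k + m + 1))"
    using sum_choose_card_tail_le[where k = k and l = "m + 1" and n = n]
    by (simp only: of_nat_le_iff add.assoc)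
  finally have "p * sum a (nsets ?V k) \<le> p * real (n choose (k + m + 1))"
    using assms(2) by (rule mult_left_mono)
  moreover have "(\<Sum>Z\<in>nsets ?V (k + 1). card (tail n Z) choose m) \<le> n choose (k + m + 1)"
    using sum_choose_card_tail_le[where k = "k + 1" and l = m and n = n] by (simp add: add_ac)
  then have "(1 - p) ^ (k + 1) * d * real (\<Sum>Z\<in>nsets ?V (k + 1). card (tail n Z) choose m)
      \<le> (1 - p) ^ (k + 1) * d * real (n choose (k + m + 1))"
    using d0 assms(3) by (intro mult_left_mono) (simp_all only: of_nat_le_iff, auto)
  ultimately have "real (card (G1 \<union> G2))
      \<le> (p + (1 - p) ^ (k + 1) * d) * real (n choose (k + m + 1))"
    using le by (simp only: distrib_right)
  then show "real (turan_number n (k + m + 1 + 1) (k + m + 1))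
      \<le> (p + (1 - p) ^ (k + 1) * d) * real (n choose (k + m + 1))"
    using turan_number_le[OF system] by linarith
qed

section \<open>Optimising the recursion\<close>

lemma turan_density_le_exp:
  assumes "turan_density_le m d" "0 \<le> d" "0 < j" "0 \<le> c" "c \<le> real j"
  shows "turan_density_le (j + m) (c / real j + exp (- c) * d)"
proof -
  define p where "p = c / real j"
  have p: "0 \<le> p" "p \<le> 1"
    using assms by (auto simp: p_def)
  have "(1 - p) ^ j \<le> exp (- c)"
    using exp_ge_one_minus_x_over_n_power_n[of c j] assms by (simp add: p_def)
  then have "p + (1 - p) ^ j * d \<le> p + exp (- c) * d"
    using assms(2) by (simp add: mult_right_mono)
  moreover have "turan_density_le (j + m) (p + (1 - p) ^ j * d)"
    using turan_density_le_rec[OF assms(1) p, of "j - 1"] assms(3) by (simp add: add_ac)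
  ultimately show ?thesis
    unfolding p_def by (rule turan_density_le_mono[rotated])
qed

text \<open>Rational lower bounds for \<open>exp c\<close> give, by reciprocals, the upper bounds
  for \<open>exp (- c)\<close> used with \<open>c = 2\<close> and \<open>c = 5 / 2\<close>.\<close>

lemma sum_le_exp:
  fixes x :: real
  assumes "0 \<le> x"
  shows "(\<Sum>i<n. x ^ i / fact i) \<le> exp x"
proof -
  have "(\<Sum>i<n. x ^ i /\<^sub>R fact i) \<le> exp x"
    unfolding exp_def using assms by (intro sum_le_suminf summable_exp_generic) auto
  then show ?thesis
    by (simp add: divide_inverse mult.commute)
qed

lemma turan_density_le_uniform: "turan_density_le r (6.239 / (real r + 1))"
proof (induction r rule: less_induct)
  case (less r)
  show ?case
  proof (cases "r \<le> 5")
    \<comment> \<open>Here \<open>r + 1 \<le> 6 < 6.239\<close>, so the trivial density 1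
      suffices.\<close>
    case True
    then show ?thesis
      by (intro turan_density_le_mono[OF turan_density_le_1]) (simp add: field_simps)
  next
    case False
    \<comment> \<open>\<open>j\<close> is \<open>(r + 1) / 2\<close> rounded up. With
      \<open>y = m + 1\<close>, the sum \<open>x + y\<close> is \<open>r + 1\<close>, and rounding
      keeps \<open>x / y\<close> between 1 and 4/3.\<close>
    define j where "j = (r + 2) div 2"
    define m where "m = r - j"
    define x y where "x = real j" and "y = real m + 1"
    have j: "2 * j \<le> r + 2" "r + 1 \<le> 2 * j"
      unfolding j_def by linarith+
    have r_eq: "r = j + m"
      using False j unfolding m_def by linarith
    have jm: "m < r" "4 \<le> j" "m + 1 \<le> j" "3 * j \<le> 4 * m + 4"
      using False j r_eq by linarith+
    have xy: "4 \<le> x" "3 \<le> y" "y \<le> x" "3 * x \<le> 4 * y" "real r + 1 = x + y"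
      using jm r_eq x_def y_def by linarith+
    have "exp (- 2) \<le> (1 / 7 :: real)"
      \<comment> \<open>The first five terms of the series for \<open>exp 2\<close> add up to
        exactly 7.\<close>
      using sum_le_exp[of 2 5] by (simp add: exp_minus field_simps eval_nat_numeral)
    then have "2 / x + exp (- 2) * (6.239 / y) \<le> 2 / x + 1 / 7 * (6.239 / y)"
      using xy by (intro add_mono mult_right_mono) auto
    also have "\<dots> \<le> 6.239 / (x + y)"
    proof -
      \<comment> \<open>The budget 6.239 is split as 4 + 2.239: the first bound uses
        \<open>y \<le> x\<close>, the second \<open>x + y \<le> 7 / 3 * y\<close>.\<close>
      have "2 / x \<le> 4 / (x + y)" "1 / 7 * (6.239 / y) \<le> 2.239 / (x + y)"
        using xy by (simp_all add: field_simps)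
      then have "2 / x + 1 / 7 * (6.239 / y) \<le> 4 / (x + y) + 2.239 / (x + y)"
        by (rule add_mono)
      also have "\<dots> = 6.239 / (x + y)"
        unfolding add_divide_distrib[symmetric] by simp
      finally show ?thesis .
    qed
    finally have "2 / x + exp (- 2) * (6.239 / y) \<le> 6.239 / (real r + 1)"
      using xy(5) by simp
    moreover have "turan_density_le (j + m) (2 / x + exp (- 2) * (6.239 / y))"
      unfolding x_def y_def using jm less.IH[OF jm(1)] by (intro turan_density_le_exp) auto
    ultimately show ?thesis
      unfolding r_eq by (rule turan_density_le_mono[rotated])
  qed
qed

section \<open>The eventual bound by iteration\<close>

lemma exp_minus_5_2_le: "exp (- (5 / 2)) \<le> (0.082086 :: real)"
proof -
  have "1 / 0.082086 \<le> (\<Sum>i<14. (5 / 2 :: real) ^ i / fact i)"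
    by (simp add: eval_nat_numeral)
  also have "\<dots> \<le> exp (5 / 2)"
    by (rule sum_le_exp) simp
  finally show ?thesis
    by (simp add: exp_minus field_simps)
qed

text \<open>The constant \<open>0.287305\<close> is slightly above \<open>7/2 exp (-5/2) = 0.28729...\<close>; the difference
  absorbs the rounding of \<open>j\<close> to an integer.\<close>

lemma turan_density_le_improve:
  assumes "\<forall>\<^sub>F r in sequentially. turan_density_le r (B / (real r + 1))" "0 \<le> B"
  shows "\<forall>\<^sub>F r in sequentially. turan_density_le r ((3.5 + 0.287305 * B) / (real r + 1))"
proof -
  obtain R where R: "\<And>r. R \<le> r \<Longrightarrow> turan_density_le r (B / (real r + 1))"
    using assms(1) by (auto simp: eventually_sequentially)
  have "turan_density_le r ((3.5 + 0.287305 * B) / (real r + 1))"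
    \<comment> \<open>The term \<open>4 * R\<close> ensures \<open>R \<le> m\<close>; the large
      constant makes the rounding error in \<open>j\<close> negligible against
      \<open>y\<close>.\<close>
    if r: "4 * R + 1000000 \<le> r" for r
  proof -
    \<comment> \<open>\<open>j\<close> is \<open>5 * (r + 1) / 7\<close> rounded up, so
      \<open>x\<close> is at least 5/7 of \<open>x + y\<close>, while
      \<open>x + y \<le> 7 / 2 * y + 3\<close>.\<close>
    define j where "j = (5 * r + 11) div 7"
    define m where "m = r - j"
    define x y where "x = real j" and "y = real m + 1"
    have j: "7 * j \<le> 5 * r + 11" "5 * r + 5 \<le> 7 * j"
      unfolding j_def by linarith+
    have r_eq: "r = j + m"
      using r j unfolding m_def by linarith
    have jm: "R \<le> m" "3 \<le> j" "5 * r + 5 \<le> 7 * j" "2 * r \<le> 7 * m + 11"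
      using r j r_eq by linarith+
    have xy: "5 * y \<le> 2 * x" "2 * x \<le> 5 * y + 6" "1000000 \<le> x + y" "1 \<le> y" "3 \<le> x"
      "real r + 1 = x + y"
      using jm r r_eq x_def y_def by linarith+
    have "(5 / 2) / x + exp (- (5 / 2)) * (B / y) \<le> (5 / 2) / x + 0.082086 * (B / y)"
      using xy assms(2) exp_minus_5_2_le by (intro add_mono mult_right_mono) auto
    also have "\<dots> \<le> (3.5 + 0.287305 * B) / (x + y)"
    proof -
      have "(5 / 2) / x \<le> 3.5 / (x + y)" "0.082086 / y \<le> 0.287305 / (x + y)"
        using xy by (simp_all add: field_simps)
      then have "(5 / 2) / x + 0.082086 / y * B \<le> 3.5 / (x + y) + 0.287305 / (x + y) * B"
        using assms(2) by (intro add_mono mult_right_mono)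
      then show ?thesis
        by (simp add: add_divide_distrib)
    qed
    finally have "(5 / 2) / x + exp (- (5 / 2)) * (B / y) \<le> (3.5 + 0.287305 * B) / (real r + 1)"
      using xy(6) by simp
    moreover have "turan_density_le (j + m) ((5 / 2) / x + exp (- (5 / 2)) * (B / y))"
      unfolding x_def y_def using jm(2) R[OF jm(1)] assms(2) by (intro turan_density_le_exp) auto
    ultimately show ?thesis
      unfolding r_eq by (rule turan_density_le_mono[rotated])
  qed
  then show ?thesis
    unfolding eventually_sequentially by blast
qed

lemma eventually_turan_density_le:
  "\<forall>\<^sub>F r in sequentially. turan_density_le r (4.911 / (real r + 1))"
proof -
  \<comment> \<open>\<open>L\<close> is the fixed point of
    \<open>B \<mapsto> 3.5 + 0.287305 * B\<close>; each step multiplies the distance to it by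
    0.287305, starting from the uniform bound 6.239.\<close>
  define L :: real where "L = 3.5 / (1 - 0.287305)"
  have "\<forall>\<^sub>F r in sequentially.
      turan_density_le r ((L + 0.287305 ^ i * (6.239 - L)) / (real r + 1))" for i
  proof (induction i)
    case 0
    show ?case
      using turan_density_le_uniform by simp
  next
    case (Suc i)
    have "0 \<le> L + 0.287305 ^ i * (6.239 - L)"
      by (intro add_nonneg_nonneg mult_nonneg_nonneg) (simp_all add: L_def)
    from turan_density_le_improve[OF Suc this] show ?case
      by (rule eventually_mono) (simp add: L_def field_simps)
  qed
  \<comment> \<open>After nine steps the excess over \<open>L\<close> is below 0.00002, while
    \<open>4.911 - L\<close> is above 0.00006.\<close>
  from this[of 9] show ?thesis
    by (rule eventually_mono)
       (erule turan_density_le_mono, intro divide_right_mono,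
        simp_all add: L_def eval_nat_numeral)
qed

theorem theorem1p1:
  shows "(\<forall>n r :: nat. 1 \<le> r \<and> r < n \<longrightarrow>
            real (turan_number n (r + 1) r) \<le> 6.239 / (real r + 1) * real (n choose r))
       \<and> (\<exists>r0 :: nat. \<forall>n r :: nat. r0 \<le> r \<and> r < n \<longrightarrow>
            real (turan_number n (r + 1) r) \<le> 4.911 / (real r + 1) * real (n choose r))"
  using turan_density_le_uniform eventually_turan_density_le
  unfolding turan_density_le_def eventually_sequentially by blast

end
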